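(* Let $\rho\ge 0$, $\gamma>2\rho$, $\gamma > 0$. (a) Let $F:\mathbb{R}^d\rightrightarrows\mathbb{R}^d$ be maximally $\rho$-star-negative comonotone and let $x^*$ satisfy $0\in F(x^* )$. Then, for any starting point $x^0\in\mathbb{R}^d$, the iterates of the Proximal Point method with stepsize $\gamma$ are well-defined and satisfy, for all $N\ge1$, $$\frac1N\sum_{k=1}^N\|x^k-x^{k-1}\|^2\le\frac{\gamma\|x^0-x^*\|^2}{(\gamma-2\rho)N}.$$ (b) Let $F:\mathbb{R}^d\rightrightarrows\mathbb{R}^d$ be maximally $\rho$-negative comonotone and let $x^*$ satisfy $0\in F(x^* )$. Then, for any starting point $x^0\in\mathbb{R}^d$ and any $k\ge1$, the iterates of the Proximal Point method with stepsize $\gamma$ satisfy $$\|x^{k+1}-x^k\|\le\|x^k-x^{k-1}\|,$$ and for any $N\ge1$ $$\|x^N-x^{N-1}\|^2\le\frac{\gamma\|x^0-x^*\|^2}{(\gamma-2\rho)N}.$$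
   Context: $F:\mathbb{R}^d\rightrightarrows\mathbb{R}^d$ denotes a set-valued operator, with graph $\{(x,u):u\in F(x)\}$; a solution is a point $x^*$ with $0\in F(x^* )$, and at least one solution is assumed to exist. For $\rho\ge0$: - $F$ is $\rho$-negative comonotone if $\langle u-v,x-y\rangle\ge-\rho\|u-v\|^2$ for all $x,y\in\mathbb{R}^d$, $u\in F(x)$, $v\in F(y)$. - $F$ is $\rho$-star-negative comonotone if $\langle u,x-x^*\rangle\ge-\rho\|u\|^2$ for all $x\in\mathbb{R}^d$, $u\in F(x)$, and $x^*$ a solution. - Such an $F$ is maximal if its graph is not strictly contained in the graph of any other $\rho$-negative comonotone (respectively, $\rho$-star-negative comonotone) operator. The Proximal Point method with stepsize $\gamma>0$ generates from $x^0$ points $x^{k+1}=x^k-\gamma F(x^{k+1})$, meaning $\frac{x^k-x^{k+1}}{\gamma}\in F(x^{k+1})$, $k\ge0$. The iterates being well-defined means that at every step a point $x^{k+1}$ satisfying this inclusion exists. *)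

theory Defs
  imports "HOL-Analysis.Analysis"
begin

text \<open>A set-valued operator on \<open>\<real>\<^sup>d\<close> is a function \<open>F :: 'a \<Rightarrow> 'a set\<close> over a Euclidean space
  \<open>'a\<close>; \<open>F x\<close> may be empty.\<close>

definition operator_graph :: "('a \<Rightarrow> 'a set) \<Rightarrow> ('a \<times> 'a) set" where
  "operator_graph F = {(x, u). u \<in> F x}"

definition is_solution :: "('a::euclidean_space \<Rightarrow> 'a set) \<Rightarrow> 'a \<Rightarrow> bool" where
  "is_solution F xs \<longleftrightarrow> 0 \<in> F xs"

definition neg_comonotone :: "real \<Rightarrow> ('a::euclidean_space \<Rightarrow> 'a set) \<Rightarrow> bool" where
  "neg_comonotone \<rho> F \<longleftrightarrow>
     (\<forall>x y. \<forall>u\<in>F x. \<forall>v\<in>F y. (u - v) \<bullet> (x - y) \<ge> - \<rho> * (norm (u - v))\<^sup>2)"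

text \<open>The inequality is required at every solution of the operator, so enlarging the graph by
  points \<open>(x, 0)\<close> adds constraints.\<close>

definition star_neg_comonotone :: "real \<Rightarrow> ('a::euclidean_space \<Rightarrow> 'a set) \<Rightarrow> bool" where
  "star_neg_comonotone \<rho> F \<longleftrightarrow>
     (\<forall>xs. is_solution F xs \<longrightarrow> (\<forall>x. \<forall>u\<in>F x. u \<bullet> (x - xs) \<ge> - \<rho> * (norm u)\<^sup>2))"

definition maximally_neg_comonotone :: "real \<Rightarrow> ('a::euclidean_space \<Rightarrow> 'a set) \<Rightarrow> bool" where
  "maximally_neg_comonotone \<rho> F \<longleftrightarrow>
     neg_comonotone \<rho> F \<and>
     (\<nexists>G. neg_comonotone \<rho> G \<and> operator_graph F \<subset> operator_graph G)"

definition maximally_star_neg_comonotone :: "real \<Rightarrow> ('a::euclidean_space \<Rightarrow> 'a set) \<Rightarrow> bool" where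
  "maximally_star_neg_comonotone \<rho> F \<longleftrightarrow>
     star_neg_comonotone \<rho> F \<and>
     (\<nexists>G. star_neg_comonotone \<rho> G \<and> operator_graph F \<subset> operator_graph G)"

definition prox_step :: "('a::euclidean_space \<Rightarrow> 'a set) \<Rightarrow> real \<Rightarrow> 'a \<Rightarrow> 'a \<Rightarrow> bool" where
  "prox_step F \<gamma> x y \<longleftrightarrow> (x - y) /\<^sub>R \<gamma> \<in> F y"

text \<open>\<open>prox_iterates F \<gamma> x0 n x\<close>: the points \<open>x 0, \<dots>, x n\<close> arise from \<open>n\<close> steps of the method started
  at \<open>x0\<close>; values of \<open>x\<close> beyond \<open>n\<close> are irrelevant. The step is an inclusion, so the iterates need
  not be unique. Every prefix of an infinite run satisfies this predicate, so a property
  of all finite runs holds in particular for infinite ones.\<close>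

definition prox_iterates ::
    "('a::euclidean_space \<Rightarrow> 'a set) \<Rightarrow> real \<Rightarrow> 'a \<Rightarrow> nat \<Rightarrow> (nat \<Rightarrow> 'a) \<Rightarrow> bool" where
  "prox_iterates F \<gamma> x0 n x \<longleftrightarrow> x 0 = x0 \<and> (\<forall>k<n. prox_step F \<gamma> (x k) (x (Suc k)))"

text \<open>Whatever choices were made in the first \<open>n\<close> steps, a further step exists.\<close>

definition prox_well_defined :: "('a::euclidean_space \<Rightarrow> 'a set) \<Rightarrow> real \<Rightarrow> 'a \<Rightarrow> bool" where
  "prox_well_defined F \<gamma> x0 \<longleftrightarrow>
     (\<forall>n x. prox_iterates F \<gamma> x0 n x \<longrightarrow> (\<exists>y. prox_step F \<gamma> (x n) y))"

end

theory Submission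
  imports Defs
begin

text \<open>
  Both parts rest on one estimate. If \<open>p - q\<close> is \<open>\<gamma>\<close> times a vector \<open>u\<close> with
  \<open>u \<bullet> q \<ge> -\<rho> \<parallel>u\<parallel>\<^sup>2\<close>, expanding \<open>\<parallel>p\<parallel>\<^sup>2 = \<parallel>q + (p - q)\<parallel>\<^sup>2\<close> gives
  \<open>\<parallel>q\<parallel>\<^sup>2 + (1 - 2\<rho>/\<gamma>) \<parallel>p - q\<parallel>\<^sup>2 \<le> \<parallel>p\<parallel>\<^sup>2\<close> (lemma \<open>norm_decrease\<close>).

  Taking \<open>p = x\<^sup>k - x\<^sup>*\<close> and \<open>q = x\<^sup>k\<^sup>+\<^sup>1 - x\<^sup>*\<close>, star-negative comonotonicity shows that each step
  reduces the squared distance to \<open>x\<^sup>*\<close> by at least \<open>(1 - 2\<rho>/\<gamma>) \<parallel>x\<^sup>k\<^sup>+\<^sup>1 - x\<^sup>k\<parallel>\<^sup>2\<close>; summing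
  telescopes to the bound on the averaged residuals. Taking \<open>p\<close> and \<open>q\<close> to be two consecutive
  differences of iterates, negative comonotonicity shows that the residuals do not increase, so
  the last one is bounded by the average.

  It remains to see that a step from any point \<open>x\<close> exists in the star-negative comonotone case.
  If \<open>x\<close> is a solution, it can be repeated. If not, maximality says that \<open>(x, 0)\<close> cannot be
  added to the graph, and the only possible obstruction is some \<open>u \<in> F z\<close> with
  \<open>u \<bullet> (z - x) < -\<rho> \<parallel>u\<parallel>\<^sup>2\<close>. The comonotonicity inequality of the pair \<open>(z, u)\<close> confines all
  solutions to a half-space with normal \<open>u\<close>, and this obstruction puts \<open>x\<close> strictly outside it.
  A short enough move from \<open>x\<close> along \<open>-u\<close> to a point \<open>y\<close> makes the pair \<open>(y, (x - y)/\<gamma>)\<close>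
  compatible with every solution, and as \<open>(x - y)/\<gamma> \<noteq> 0\<close>, adding it creates no new solution;
  so by maximality it lies in the graph already.
\<close>

lemma norm_decrease:
  fixes p q :: "'a::real_inner" and \<rho> \<gamma> :: real
  assumes "\<gamma> > 0"
    and "((p - q) /\<^sub>R \<gamma>) \<bullet> q \<ge> - \<rho> * (norm ((p - q) /\<^sub>R \<gamma>))\<^sup>2"
  shows "(norm q)\<^sup>2 + (1 - 2 * \<rho> / \<gamma>) * (norm (p - q))\<^sup>2 \<le> (norm p)\<^sup>2"
proof -
  have "- \<rho> * ((norm (p - q))\<^sup>2 / \<gamma>\<^sup>2) \<le> ((p - q) \<bullet> q) / \<gamma>"
    using assms by (simp add: power_mult_distrib power_inverse divide_inverse mult_ac)
  then have "\<gamma> * (- \<rho> * ((norm (p - q))\<^sup>2 / \<gamma>\<^sup>2)) \<le> \<gamma> * (((p - q) \<bullet> q) / \<gamma>)"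
    using assms(1) by (intro mult_left_mono) auto
  then have "- (\<rho> / \<gamma>) * (norm (p - q))\<^sup>2 \<le> (p - q) \<bullet> q"
    using assms(1) by (simp add: power2_eq_square)
  moreover have "(norm p)\<^sup>2 = (norm q)\<^sup>2 + (norm (p - q))\<^sup>2 + 2 * ((p - q) \<bullet> q)"
    unfolding power2_norm_eq_inner by (simp add: inner_diff_left inner_diff_right inner_commute)
  moreover have "(1 - 2 * \<rho> / \<gamma>) * (norm (p - q))\<^sup>2
      = (norm (p - q))\<^sup>2 + 2 * (- (\<rho> / \<gamma>) * (norm (p - q))\<^sup>2)"
    by (simp add: algebra_simps)
  ultimately show ?thesis
    by linarith
qed

text \<open>A single new pair \<open>(y, u)\<close> is tested only against the old solutions when \<open>u\<close> is nonzero;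
  a new pair \<open>(x, 0)\<close> is tested only against the old graph. The next two lemmas are what
  maximality says about these two kinds of extension.\<close>

lemma maximally_star_neg_comonotone_mem:
  assumes "maximally_star_neg_comonotone \<rho> F" and "u \<noteq> 0"
    and "\<And>s. is_solution F s \<Longrightarrow> u \<bullet> (y - s) \<ge> - \<rho> * (norm u)\<^sup>2"
  shows "u \<in> F y"
proof (rule ccontr)
  assume "u \<notin> F y"
  let ?G = "F(y := insert u (F y))"
  have "is_solution ?G s \<longleftrightarrow> is_solution F s" for s
    using \<open>u \<noteq> 0\<close> by (auto simp: is_solution_def)
  then have "star_neg_comonotone \<rho> ?G"
    using assms unfolding star_neg_comonotone_def maximally_star_neg_comonotone_def
    by (auto split: if_splits)
  moreover have "operator_graph F \<subset> operator_graph ?G"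
    using \<open>u \<notin> F y\<close> by (auto simp: operator_graph_def split: if_splits)
  ultimately show False
    using assms(1) unfolding maximally_star_neg_comonotone_def by blast
qed

lemma maximally_star_neg_comonotone_obstruction:
  assumes "maximally_star_neg_comonotone \<rho> F" and "\<not> is_solution F x"
  obtains z u where "u \<in> F z" and "u \<bullet> (z - x) < - \<rho> * (norm u)\<^sup>2"
proof (rule ccontr)
  assume "\<not> thesis"
  then have no_obstruction: "\<forall>z. \<forall>u\<in>F z. u \<bullet> (z - x) \<ge> - \<rho> * (norm u)\<^sup>2"
    using that by (meson not_le)
  let ?G = "F(x := insert 0 (F x))"
  have F: "star_neg_comonotone \<rho> F"
    using assms(1) by (simp add: maximally_star_neg_comonotone_def)
  have "star_neg_comonotone \<rho> ?G"
    unfolding star_neg_comonotone_def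
  proof (intro allI impI ballI)
    fix s z u assume "is_solution ?G s" and "u \<in> ?G z"
    then have "s = x \<or> is_solution F s" and "u = 0 \<or> u \<in> F z"
      by (auto simp: is_solution_def split: if_splits)
    then show "u \<bullet> (z - s) \<ge> - \<rho> * (norm u)\<^sup>2"
      using no_obstruction F unfolding star_neg_comonotone_def by auto
  qed
  moreover have "operator_graph F \<subset> operator_graph ?G"
    using assms(2) by (auto simp: operator_graph_def is_solution_def split: if_splits)
  ultimately show False
    using assms(1) unfolding maximally_star_neg_comonotone_def by blast
qed

lemma prox_step_exists:
  assumes "maximally_star_neg_comonotone \<rho> F" and "\<rho> \<ge> 0" and "\<gamma> > 0"
  shows "\<exists>y. prox_step F \<gamma> x y"
proof (cases "is_solution F x")
  case True
  then have "prox_step F \<gamma> x x"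
    by (simp add: prox_step_def is_solution_def)
  then show ?thesis ..
next
  case False
  then obtain z u where u: "u \<in> F z" and obs: "u \<bullet> (z - x) < - \<rho> * (norm u)\<^sup>2"
    using maximally_star_neg_comonotone_obstruction assms(1) by blast
  have "u \<noteq> 0"
    using obs by auto
  define c where "c = - \<rho> * (norm u)\<^sup>2 - u \<bullet> (z - x)"
  have "c > 0"
    using obs by (simp add: c_def)
  \<comment> \<open>The gap \<open>c\<close> bounds from below how far \<open>x\<close> lies beyond every solution in direction \<open>u\<close>.\<close>
  have gap: "u \<bullet> (x - s) \<ge> c" if "is_solution F s" for s
  proof -
    have "u \<bullet> (z - s) \<ge> - \<rho> * (norm u)\<^sup>2"
      using assms(1) u that
      unfolding maximally_star_neg_comonotone_def star_neg_comonotone_def by blast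
    then show ?thesis
      by (simp add: c_def inner_diff_right)
  qed
  \<comment> \<open>With the step \<open>t u\<close> the inequality to be met is \<open>t (u \<bullet> (x - s)) \<ge> (1 - \<rho>/\<gamma>) t\<^sup>2 \<parallel>u\<parallel>\<^sup>2\<close>; the
    choice below achieves it even without the favourable term \<open>\<rho>/\<gamma>\<close>, since \<open>t \<parallel>u\<parallel>\<^sup>2 = c\<close>.\<close>
  define t where "t = c / (norm u)\<^sup>2"
  have "t > 0" and tu: "t * (u \<bullet> u) = c"
    using \<open>c > 0\<close> \<open>u \<noteq> 0\<close> by (auto simp: t_def power2_norm_eq_inner)
  define v where "v = (t / \<gamma>) *\<^sub>R u"
  have "v \<noteq> 0"
    using \<open>t > 0\<close> \<open>\<gamma> > 0\<close> \<open>u \<noteq> 0\<close> by (simp add: v_def)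
  have "v \<in> F (x - t *\<^sub>R u)"
  proof (rule maximally_star_neg_comonotone_mem[OF assms(1) \<open>v \<noteq> 0\<close>])
    fix s assume "is_solution F s"
    then have "u \<bullet> (x - t *\<^sub>R u - s) \<ge> 0"
      using gap[of s] tu by (simp add: inner_diff_right)
    then have "v \<bullet> (x - t *\<^sub>R u - s) \<ge> 0"
      using \<open>t > 0\<close> \<open>\<gamma> > 0\<close> by (simp add: v_def)
    moreover have "- \<rho> * (norm v)\<^sup>2 \<le> 0"
      using \<open>\<rho> \<ge> 0\<close> by simp
    ultimately show "v \<bullet> (x - t *\<^sub>R u - s) \<ge> - \<rho> * (norm v)\<^sup>2"
      by linarith
  qed
  then have "prox_step F \<gamma> x (x - t *\<^sub>R u)"
    by (simp add: prox_step_def v_def divide_inverse mult.commute)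
  then show ?thesis ..
qed

lemma prox_step_distance_decrease:
  assumes "star_neg_comonotone \<rho> F" and "is_solution F s" and "\<gamma> > 0" and "prox_step F \<gamma> x y"
  shows "(norm (y - s))\<^sup>2 + (1 - 2 * \<rho> / \<gamma>) * (norm (y - x))\<^sup>2 \<le> (norm (x - s))\<^sup>2"
proof -
  have "((x - y) /\<^sub>R \<gamma>) \<bullet> (y - s) \<ge> - \<rho> * (norm ((x - y) /\<^sub>R \<gamma>))\<^sup>2"
    using assms(1,2,4) unfolding star_neg_comonotone_def prox_step_def by blast
  then have "(norm (y - s))\<^sup>2 + (1 - 2 * \<rho> / \<gamma>) * (norm ((x - s) - (y - s)))\<^sup>2
      \<le> (norm (x - s))\<^sup>2"
    using assms(3) by (intro norm_decrease) auto
  then show ?thesis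
    by (simp add: norm_minus_commute[of y x])
qed

lemma prox_residual_antimono:
  assumes "neg_comonotone \<rho> F" and "\<gamma> > 2 * \<rho>" and "\<gamma> > 0"
    and "prox_step F \<gamma> x y" and "prox_step F \<gamma> y z"
  shows "norm (z - y) \<le> norm (y - x)"
proof -
  have "(norm (y - z))\<^sup>2 + (1 - 2 * \<rho> / \<gamma>) * (norm ((x - y) - (y - z)))\<^sup>2 \<le> (norm (x - y))\<^sup>2"
    using assms(1,3-5) unfolding neg_comonotone_def prox_step_def
    by (intro norm_decrease) (auto simp: scaleR_diff_right)
  moreover have "(1 - 2 * \<rho> / \<gamma>) * (norm ((x - y) - (y - z)))\<^sup>2 \<ge> 0"
    using assms(2,3) by simp
  ultimately have "(norm (y - z))\<^sup>2 \<le> (norm (x - y))\<^sup>2"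
    by linarith
  then have "norm (y - z) \<le> norm (x - y)"
    by (rule power2_le_imp_le) simp
  then show ?thesis
    by (simp add: norm_minus_commute)
qed

lemma prox_residual_sum_telescope:
  assumes "star_neg_comonotone \<rho> F" and "is_solution F s" and "\<gamma> > 0"
    and "prox_iterates F \<gamma> x0 N x"
  shows "(norm (x N - s))\<^sup>2 + (1 - 2 * \<rho> / \<gamma>) * (\<Sum>k=1..N. (norm (x k - x (k - 1)))\<^sup>2)
           \<le> (norm (x0 - s))\<^sup>2"
  using assms(4)
proof (induction N)
  case 0
  then show ?case by (simp add: prox_iterates_def)
next
  case (Suc N)
  then have "prox_iterates F \<gamma> x0 N x" and "prox_step F \<gamma> (x N) (x (Suc N))"
    by (auto simp: prox_iterates_def)
  with Suc.IH prox_step_distance_decrease[OF assms(1-3), of "x N" "x (Suc N)"] show ?case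
    by (simp add: distrib_left)
qed

lemma prox_residual_sum_le:
  assumes "star_neg_comonotone \<rho> F" and "is_solution F s" and "\<gamma> > 2 * \<rho>" and "\<gamma> > 0"
    and "prox_iterates F \<gamma> x0 N x"
  shows "(\<Sum>k=1..N. (norm (x k - x (k - 1)))\<^sup>2) \<le> \<gamma> * (norm (x0 - s))\<^sup>2 / (\<gamma> - 2 * \<rho>)"
proof -
  let ?S = "\<Sum>k=1..N. (norm (x k - x (k - 1)))\<^sup>2"
  have "(1 - 2 * \<rho> / \<gamma>) * ?S \<le> (norm (x0 - s))\<^sup>2"
    using prox_residual_sum_telescope[OF assms(1,2,4,5)] zero_le_power2[of "norm (x N - s)"]
    by linarith
  then have "\<gamma> * ((1 - 2 * \<rho> / \<gamma>) * ?S) \<le> \<gamma> * (norm (x0 - s))\<^sup>2"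
    using assms(4) by (intro mult_left_mono) auto
  moreover have "\<gamma> * ((1 - 2 * \<rho> / \<gamma>) * ?S) = ?S * (\<gamma> - 2 * \<rho>)"
    using assms(4) by (simp add: field_simps)
  ultimately have "?S * (\<gamma> - 2 * \<rho>) \<le> \<gamma> * (norm (x0 - s))\<^sup>2"
    by linarith
  then show ?thesis
    using assms(3) by (simp add: pos_le_divide_eq)
qed

lemma neg_comonotone_imp_star_neg_comonotone:
  assumes "neg_comonotone \<rho> F"
  shows "star_neg_comonotone \<rho> F"
  using assms unfolding neg_comonotone_def star_neg_comonotone_def is_solution_def
  by (metis diff_zero)

lemma prox_last_residual_le:
  assumes "neg_comonotone \<rho> F" and "is_solution F s" and "\<gamma> > 2 * \<rho>" and "\<gamma> > 0"
    and "N \<ge> 1" and "prox_iterates F \<gamma> x0 N x"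
  shows "(norm (x N - x (N - 1)))\<^sup>2 \<le> \<gamma> * (norm (x0 - s))\<^sup>2 / ((\<gamma> - 2 * \<rho>) * real N)"
proof -
  have iter: "prox_step F \<gamma> (x k) (x (Suc k))" if "k < N" for k
    using assms(6) that by (simp add: prox_iterates_def)
  have antimono: "norm (x N - x (N - 1)) \<le> norm (x k - x (k - 1))" if "k \<le> N" "1 \<le> k" for k
    using that
  proof (induction k rule: inc_induct)
    case (step k)
    then have "norm (x (Suc k) - x k) \<le> norm (x k - x (k - 1))"
      using prox_residual_antimono[OF assms(1,3,4), of "x (k - 1)" "x k" "x (Suc k)"]
        iter[of k] iter[of "k - 1"] by simp
    with step show ?case by simp
  qed simp
  have "real N * (norm (x N - x (N - 1)))\<^sup>2 = (\<Sum>k=1..N. (norm (x N - x (N - 1)))\<^sup>2)"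
    by simp
  also have "\<dots> \<le> (\<Sum>k=1..N. (norm (x k - x (k - 1)))\<^sup>2)"
    using antimono by (intro sum_mono power_mono) auto
  also have "\<dots> \<le> \<gamma> * (norm (x0 - s))\<^sup>2 / (\<gamma> - 2 * \<rho>)"
    using prox_residual_sum_le[OF neg_comonotone_imp_star_neg_comonotone] assms by blast
  finally have "(norm (x N - x (N - 1)))\<^sup>2 \<le> \<gamma> * (norm (x0 - s))\<^sup>2 / (\<gamma> - 2 * \<rho>) / real N"
    using \<open>N \<ge> 1\<close> by (subst pos_le_divide_eq) (simp_all add: mult.commute)
  then show ?thesis
    by simp
qed

theorem theorem3p1:
  fixes \<rho> \<gamma> :: real
  assumes "\<rho> \<ge> 0" and "\<gamma> > 2 * \<rho>" and "\<gamma> > 0"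
  shows
    "(\<forall>(F :: 'a::euclidean_space \<Rightarrow> 'a set) xs.
        maximally_star_neg_comonotone \<rho> F \<longrightarrow> is_solution F xs \<longrightarrow>
        (\<forall>x0. prox_well_defined F \<gamma> x0 \<and>
           (\<forall>N\<ge>1. \<forall>x. prox_iterates F \<gamma> x0 N x \<longrightarrow>
              (1 / real N) * (\<Sum>k=1..N. (norm (x k - x (k - 1)))\<^sup>2)
                \<le> \<gamma> * (norm (x0 - xs))\<^sup>2 / ((\<gamma> - 2 * \<rho>) * real N))))
     \<and>
     (\<forall>(F :: 'a \<Rightarrow> 'a set) xs.
        maximally_neg_comonotone \<rho> F \<longrightarrow> is_solution F xs \<longrightarrow>
        (\<forall>x0.
           (\<forall>k\<ge>1. \<forall>x. prox_iterates F \<gamma> x0 (k + 1) x \<longrightarrow>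
              norm (x (k + 1) - x k) \<le> norm (x k - x (k - 1))) \<and>
           (\<forall>N\<ge>1. \<forall>x. prox_iterates F \<gamma> x0 N x \<longrightarrow>
              (norm (x N - x (N - 1)))\<^sup>2
                \<le> \<gamma> * (norm (x0 - xs))\<^sup>2 / ((\<gamma> - 2 * \<rho>) * real N))))"
proof (intro conjI allI impI)
  fix F :: "'a \<Rightarrow> 'a set" and xs x0
  assume F: "maximally_star_neg_comonotone \<rho> F" and xs: "is_solution F xs"
  show "prox_well_defined F \<gamma> x0"
    using prox_step_exists[OF F assms(1,3)] by (simp add: prox_well_defined_def)
  fix N :: nat and x
  assume "1 \<le> N" and "prox_iterates F \<gamma> x0 N x"
  then have "(\<Sum>k=1..N. (norm (x k - x (k - 1)))\<^sup>2) \<le> \<gamma> * (norm (x0 - xs))\<^sup>2 / (\<gamma> - 2 * \<rho>)"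
    using prox_residual_sum_le F xs assms(2,3) unfolding maximally_star_neg_comonotone_def by blast
  then have "(\<Sum>k=1..N. (norm (x k - x (k - 1)))\<^sup>2) / real N
      \<le> \<gamma> * (norm (x0 - xs))\<^sup>2 / (\<gamma> - 2 * \<rho>) / real N"
    by (rule divide_right_mono) simp
  then show "(1 / real N) * (\<Sum>k=1..N. (norm (x k - x (k - 1)))\<^sup>2)
      \<le> \<gamma> * (norm (x0 - xs))\<^sup>2 / ((\<gamma> - 2 * \<rho>) * real N)"
    by simp
next
  fix F :: "'a \<Rightarrow> 'a set" and xs x0 x and k :: nat
  assume F: "maximally_neg_comonotone \<rho> F" and "1 \<le> k"
    and "prox_iterates F \<gamma> x0 (k + 1) x"
  then have "prox_step F \<gamma> (x j) (x (Suc j))" if "j < k + 1" for j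
    using that by (simp add: prox_iterates_def)
  from this[of "k - 1"] this[of k]
  have "prox_step F \<gamma> (x (k - 1)) (x (Suc (k - 1)))" and "prox_step F \<gamma> (x k) (x (Suc k))"
    by simp_all
  moreover have "neg_comonotone \<rho> F"
    using F by (simp add: maximally_neg_comonotone_def)
  ultimately show "norm (x (k + 1) - x k) \<le> norm (x k - x (k - 1))"
    using prox_residual_antimono[of \<rho> F \<gamma> "x (k - 1)" "x k" "x (k + 1)"] assms(2,3) \<open>1 \<le> k\<close>
    by simp
next
  fix F :: "'a \<Rightarrow> 'a set" and xs x0 x and N :: nat
  assume "maximally_neg_comonotone \<rho> F" and "is_solution F xs" and "1 \<le> N"
    and "prox_iterates F \<gamma> x0 N x"
  then show "(norm (x N - x (N - 1)))\<^sup>2 \<le> \<gamma> * (norm (x0 - xs))\<^sup>2 / ((\<gamma> - 2 * \<rho>) * real N)"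
    using prox_last_residual_le assms(2,3) unfolding maximally_neg_comonotone_def by blast
qed

end
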